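(* Let $k\ge 2$ and $0\le\alpha<1$. Let $G$ be a $k$-uniform hypergraph with $n$ vertices and $m$ edges, and let $\Delta$ and $\delta$ be the maximum and minimum degrees of $G$, respectively. Then $$\rho_{\alpha}(G)-\frac{km}{n}\ \ge\ \frac{\alpha}{2n}\left(\frac{2\left(\Delta^{\frac{2k-1}{k-1}}+\delta^{\frac{2k-1}{k-1}}\right)}{\Delta^{\frac{k}{k-1}}+\delta^{\frac{k}{k-1}}}-(\Delta+\delta)\right)+\frac{(1-\alpha)k}{2n}\left(2^{\frac1k}\left(\Delta^{\frac{k}{k-1}}+\delta^{\frac{k}{k-1}}\right)^{\frac{k-1}{k}}-(\Delta+\delta)\right).$$
   Context: A $k$-uniform hypergraph $G=(V(G),E(G))$ has a finite vertex set $V(G)$ (identified with $[n]=\{1,\dots,n\}$) and an edge set $E(G)$ consisting of distinct $k$-element subsets of $V(G)$; hypergraphs are assumed to have at least one edge. The degree $d_i$ of a vertex $i$ is the number of edges containing $i$. The adjacency tensor $\mathcal{A}(G)$ is the tensor of order $k$ and dimension $n$ with entries $a_{i_1\ldots i_k}=\frac{1}{(k-1)!}$ if $\{i_1,\dots,i_k\}\in E(G)$ and $0$ otherwise; $\mathcal{D}(G)$ is the diagonal tensor of order $k$ and dimension $n$ with diagonal entries $d_{i\ldots i}=d_i$ and all other entries $0$. For $0\le\alpha<1$, $\mathcal{A}_\alpha(G)=\alpha\mathcal{D}(G)+(1-\alpha)\mathcal{A}(G)$. For a tensor $\mathcal{T}=(t_{i_1\ldots i_k})$ of order $k$ and dimension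 $n$ and $x\in\mathbb{C}^n$, $(\mathcal{T}x)_i=\sum_{i_2,\dots,i_k=1}^n t_{ii_2\ldots i_k}x_{i_2}\cdots x_{i_k}$. A number $\lambda\in\mathbb{C}$ is an eigenvalue of $\mathcal{T}$ with eigenvector $0\ne x\in\mathbb{C}^n$ if $(\mathcal{T}x)_i=\lambda x_i^{k-1}$ for all $i$; the spectral radius $\rho(\mathcal{T})$ is the maximum of $|\lambda|$ over eigenvalues $\lambda$ of $\mathcal{T}$. $\rho_\alpha(G)=\rho(\mathcal{A}_\alpha(G))$. *)

theory Defs
  imports "HOL-Analysis.Analysis"
begin

text \<open>The vertex set is the whole finite type \<open>'n\<close>, so the number of vertices is \<open>CARD('n)\<close>.\<close>

definition uniform_hypergraph :: "nat \<Rightarrow> 'n::finite set set \<Rightarrow> bool" where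
  "uniform_hypergraph k E \<longleftrightarrow> E \<noteq> {} \<and> (\<forall>e\<in>E. card e = k)"

definition degree :: "'n::finite set set \<Rightarrow> 'n \<Rightarrow> nat" where
  "degree E i = card {e \<in> E. i \<in> e}"

definition max_degree :: "'n::finite set set \<Rightarrow> nat" where
  "max_degree E = Max (range (degree E))"

definition min_degree :: "'n::finite set set \<Rightarrow> nat" where
  "min_degree E = Min (range (degree E))"

text \<open>A tensor of order \<open>k\<close> is a function on index lists, of which only the entries at
  lists of length \<open>k\<close> are meaningful; all operations below look at those entries only.\<close>

type_synonym 'n tensor = "'n list \<Rightarrow> complex"

definition tensor_apply :: "nat \<Rightarrow> 'n::finite tensor \<Rightarrow> complex ^ 'n \<Rightarrow> complex ^ 'n" where
  "tensor_apply k T x =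
     (\<chi> i. \<Sum>js | length js = k - 1. T (i # js) * prod_list (map (\<lambda>j. x $ j) js))"

definition tensor_eigenvalue :: "nat \<Rightarrow> 'n::finite tensor \<Rightarrow> complex \<Rightarrow> bool" where
  "tensor_eigenvalue k T l \<longleftrightarrow>
     (\<exists>x. x \<noteq> 0 \<and> (\<forall>i. tensor_apply k T x $ i = l * (x $ i) ^ (k - 1)))"

text \<open>\<open>GREATEST\<close> is the maximum of the moduli; \<open>Max\<close> would be meaningful only after
  proving that there are finitely many eigenvalues.\<close>

definition tensor_spectral_radius :: "nat \<Rightarrow> 'n::finite tensor \<Rightarrow> real" where
  "tensor_spectral_radius k T = (GREATEST r. \<exists>l. tensor_eigenvalue k T l \<and> r = cmod l)"

text \<open>For a list of length \<open>k\<close> whose set of entries is an edge of a \<open>k\<close>-uniform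
  hypergraph, the entries are automatically distinct.\<close>

definition adjacency_tensor :: "nat \<Rightarrow> 'n::finite set set \<Rightarrow> 'n tensor" where
  "adjacency_tensor k E js = (if set js \<in> E then 1 / fact (k - 1) else 0)"

definition degree_tensor :: "nat \<Rightarrow> 'n::finite set set \<Rightarrow> 'n tensor" where
  "degree_tensor k E js = (if js = replicate k (hd js) then of_nat (degree E (hd js)) else 0)"

definition A_alpha :: "nat \<Rightarrow> real \<Rightarrow> 'n::finite set set \<Rightarrow> 'n tensor" where
  "A_alpha k \<alpha> E js =
     of_real \<alpha> * degree_tensor k E js + of_real (1 - \<alpha>) * adjacency_tensor k E js"

definition rho_alpha :: "nat \<Rightarrow> real \<Rightarrow> 'n::finite set set \<Rightarrow> real" where
  "rho_alpha k \<alpha> E = tensor_spectral_radius k (A_alpha k \<alpha> E)"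

end

theory Submission
  imports Defs "HOL-Combinatorics.Multiset_Permutations"
begin

text \<open>On nonnegative vectors the homogeneous form of the tensor is
  \<open>F x = \<alpha> (\<Sum>i. d\<^sub>i x\<^sub>i^k) + (1 - \<alpha>) k (\<Sum>e\<in>E. \<Prod>j\<in>e. x\<^sub>j)\<close>, and its maximum over the nonnegative
  part of the unit sphere of the \<open>k\<close>-norm is the spectral radius: a maximizer is an eigenvector by a
  one-variable Lagrange argument in each coordinate, and every eigenvalue satisfies
  \<open>\<bar>\<lambda>\<bar> (\<Sum>i. \<bar>x\<^sub>i\<bar>^k) \<le> F \<bar>x\<bar>\<close>. Hence \<open>F x \<le> \<rho> (\<Sum>i. x\<^sub>i^k)\<close>. Let \<open>u\<close> and \<open>v\<close> have maximum and minimum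
  degree. Replacing the \<open>u\<close>-entry of the all-ones vector by \<open>a\<close>, and its \<open>v\<close>-entry by \<open>b\<close>, where
  \<open>a^k\<close> and \<open>b^k\<close> are proportional to \<open>\<Delta>^(k/(k-1))\<close> and \<open>\<delta>^(k/(k-1))\<close> with sum \<open>2\<close>, gives two such
  inequalities, whose sum is the claim. Using two vectors instead of changing both
  entries at once avoids the edges containing both \<open>u\<close> and \<open>v\<close>.\<close>

text \<open>For \<open>x\<close> with variable entries this is the partial derivative in
  \<open>x i\<close> of the sum of all edge products. The semiring type lets it serve complex
  eigenvectors and the real form alike.\<close>

definition link_sum :: "'n::finite set set \<Rightarrow> ('n \<Rightarrow> 'a::comm_semiring_1) \<Rightarrow> 'n \<Rightarrow> 'a" where
  "link_sum E x i = (\<Sum>e | e \<in> E \<and> i \<in> e. \<Prod>j\<in>e - {i}. x j)"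

text \<open>This is the pairing of \<open>x\<close> with its image under the tensor. Each edge
  product arises there once from each of its \<open>k\<close> vertices, whence the factor
  \<open>real k\<close>.\<close>

definition A_alpha_form :: "nat \<Rightarrow> real \<Rightarrow> 'n::finite set set \<Rightarrow> ('n \<Rightarrow> real) \<Rightarrow> real" where
  "A_alpha_form k \<alpha> E x =
     \<alpha> * (\<Sum>i\<in>UNIV. real (degree E i) * x i ^ k) + (1 - \<alpha>) * real k * (\<Sum>e\<in>E. \<Prod>j\<in>e. x j)"

section \<open>Double counting of vertex-edge incidences\<close>

lemma uniform_hypergraph_card: "uniform_hypergraph k E \<Longrightarrow> e \<in> E \<Longrightarrow> card e = k"
  by (simp add: uniform_hypergraph_def)

text \<open>After exchanging the sums, \<open>f e\<close> is counted once for each of the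
  \<open>k\<close> vertices of \<open>e\<close>. The case \<open>f = 1\<close> over the naturals
  gives the degree sum; edge products give the pairing of \<open>x\<close> with its link
  sums.\<close>

lemma sum_incident:
  fixes f :: "'n::finite set \<Rightarrow> 'a::comm_semiring_1"
  assumes "uniform_hypergraph k E"
  shows "(\<Sum>i\<in>UNIV. \<Sum>e | e \<in> E \<and> i \<in> e. f e) = of_nat k * (\<Sum>e\<in>E. f e)"
proof -
  have "(\<Sum>i\<in>UNIV. \<Sum>e | e \<in> E \<and> i \<in> e. f e) = (\<Sum>e\<in>E. \<Sum>i | i \<in> UNIV \<and> i \<in> e. f e)"
    by (rule sum.swap_restrict) auto
  also have "\<dots> = (\<Sum>e\<in>E. of_nat k * f e)"
    by (rule sum.cong) (auto simp: uniform_hypergraph_card[OF assms])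
  finally show ?thesis by (simp add: sum_distrib_left)
qed

lemma sum_degree:
  assumes "uniform_hypergraph k E"
  shows "(\<Sum>i\<in>UNIV. degree E i) = k * card E"
  using sum_incident[OF assms, of "\<lambda>_. 1 :: nat"] by (simp add: degree_def)

lemma prod_incident:
  fixes x :: "'n::finite \<Rightarrow> 'a::comm_semiring_1"
  shows "i \<in> e \<Longrightarrow> (\<Prod>j\<in>e. x j) = x i * (\<Prod>j\<in>e - {i}. x j)"
  by (rule prod.remove) auto

lemma sum_link_sum:
  fixes x :: "'n::finite \<Rightarrow> 'a::comm_semiring_1"
  assumes "uniform_hypergraph k E"
  shows "(\<Sum>i\<in>UNIV. x i * link_sum E x i) = of_nat k * (\<Sum>e\<in>E. \<Prod>j\<in>e. x j)"
proof -
  have "x i * link_sum E x i = (\<Sum>e | e \<in> E \<and> i \<in> e. \<Prod>j\<in>e. x j)" for i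
    unfolding link_sum_def sum_distrib_left
    by (rule sum.cong) (auto simp: prod_incident)
  then show ?thesis by (simp add: sum_incident[OF assms])
qed

section \<open>Coordinates of the tensor action\<close>

lemma lists_completing_edge:
  fixes E :: "'n::finite set set"
  assumes "uniform_hypergraph k E" and "k > 0"
  shows "{js. length js = k - 1 \<and> insert i (set js) \<in> E} =
    (\<Union>e\<in>{e \<in> E. i \<in> e}. permutations_of_set (e - {i}))"
proof (intro equalityI subsetI)
  fix js assume "js \<in> {js. length js = k - 1 \<and> insert i (set js) \<in> E}"
  then have js: "length js = k - 1" "insert i (set js) \<in> E" by auto
  \<comment> \<open>Only \<open>k\<close> entries are available to form a set of \<open>k\<close>
    elements, so no entry is repeated and \<open>i\<close> is not among \<open>js\<close>.\<close>
  have "card (insert i (set js)) = k" using uniform_hypergraph_card[OF assms(1) js(2)] .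
  then have "i \<notin> set js" "distinct js"
    using js(1) assms(2) card_length[of js]
    by (auto simp: card_insert_if split: if_splits intro!: card_distinct)
  then show "js \<in> (\<Union>e\<in>{e \<in> E. i \<in> e}. permutations_of_set (e - {i}))"
    using js by (intro UN_I[of "insert i (set js)"]) (auto simp: permutations_of_set_def)
next
  fix js assume "js \<in> (\<Union>e\<in>{e \<in> E. i \<in> e}. permutations_of_set (e - {i}))"
  then obtain e where e: "e \<in> E" "i \<in> e" "set js = e - {i}" "distinct js"
    by (auto simp: permutations_of_set_def)
  have "insert i (set js) = e" using e by auto
  moreover have "length js = k - 1"
    using e uniform_hypergraph_card[OF assms(1) e(1)] distinct_card[OF e(4)] by simp
  ultimately show "js \<in> {js. length js = k - 1 \<and> insert i (set js) \<in> E}" using e by auto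
qed

text \<open>Each edge through \<open>i\<close> is met by the \<open>(k - 1)!\<close> orderings of
  its remaining vertices, all with the same product; this cancels the normalisation
  \<open>1 / fact (k - 1)\<close>.\<close>

lemma sum_adjacency_tensor:
  fixes x :: "'n::finite \<Rightarrow> complex"
  assumes "uniform_hypergraph k E" and "k > 0"
  shows "(\<Sum>js | length js = k - 1. adjacency_tensor k E (i # js) * prod_list (map x js))
    = link_sum E x i"
proof -
  let ?P = "\<lambda>js. prod_list (map x js) / fact (k - 1)"
  have fin: "finite {js::'n list. length js = k - 1}"
    using finite_lists_length_eq[of "UNIV :: 'n set"] by simp
  \<comment> \<open>Both edges contain \<open>i\<close>, so each is recovered from the set of
    entries of any of its lists.\<close>
  have disj: "permutations_of_set (e - {i}) \<inter> permutations_of_set (e' - {i}) = {}"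
    if "i \<in> e" "i \<in> e'" "e \<noteq> e'" for e e'
    using that by (auto simp: permutations_of_set_def)
  have "(\<Sum>js | length js = k - 1. adjacency_tensor k E (i # js) * prod_list (map x js))
      = (\<Sum>js | length js = k - 1 \<and> insert i (set js) \<in> E. ?P js)"
    using fin by (intro sum.mono_neutral_cong_right) (auto simp: adjacency_tensor_def)
  also have "\<dots> = (\<Sum>e | e \<in> E \<and> i \<in> e. \<Sum>js\<in>permutations_of_set (e - {i}). ?P js)"
    unfolding lists_completing_edge[OF assms]
    by (rule sum.UNION_disjoint) (use disj in auto)
  also have "\<dots> = link_sum E x i"
    unfolding link_sum_def
  proof (rule sum.cong)
    fix e assume "e \<in> {e. e \<in> E \<and> i \<in> e}"
    then have c: "card (e - {i}) = k - 1"
      using uniform_hypergraph_card[OF assms(1)] by simp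
    have "?P js = (\<Prod>j\<in>e - {i}. x j) / fact (k - 1)"
      if "js \<in> permutations_of_set (e - {i})" for js
      using that prod.distinct_set_conv_list[of js x]
      by (simp only: permutations_of_set_def mem_Collect_eq)
    then show "(\<Sum>js\<in>permutations_of_set (e - {i}). ?P js) = (\<Prod>j\<in>e - {i}. x j)"
      by (simp add: c)
  qed simp
  finally show ?thesis .
qed

lemma sum_degree_tensor:
  fixes x :: "'n::finite \<Rightarrow> complex"
  assumes "k > 0"
  shows "(\<Sum>js | length js = k - 1. degree_tensor k E (i # js) * prod_list (map x js))
    = of_nat (degree E i) * x i ^ (k - 1)"
proof -
  have fin: "finite {js::'n list. length js = k - 1}"
    using finite_lists_length_eq[of "UNIV :: 'n set"] by simp
  have "replicate k i = i # replicate (k - 1) i"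
    using assms by (cases k) auto
  then have "degree_tensor k E (i # js) =
      (if js = replicate (k - 1) i then of_nat (degree E i) else 0)" for js
    by (simp add: degree_tensor_def)
  then have "(\<Sum>js | length js = k - 1. degree_tensor k E (i # js) * prod_list (map x js))
     = (\<Sum>js | length js = k - 1. if js = replicate (k - 1) i
          then of_nat (degree E i) * prod_list (map x js) else 0)"
    by (intro sum.cong) auto
  also have "\<dots> = of_nat (degree E i) * x i ^ (k - 1)"
    using fin by simp
  finally show ?thesis .
qed

lemma tensor_apply_A_alpha:
  fixes x :: "complex ^ 'n::finite"
  assumes "uniform_hypergraph k E" and "k > 0"
  shows "tensor_apply k (A_alpha k \<alpha> E) x $ i =
    of_real \<alpha> * of_nat (degree E i) * (x $ i) ^ (k - 1)
      + of_real (1 - \<alpha>) * link_sum E (($) x) i"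
proof -
  have "tensor_apply k (A_alpha k \<alpha> E) x $ i =
      of_real \<alpha> * (\<Sum>js | length js = k - 1. degree_tensor k E (i # js) * prod_list (map (($) x) js))
      + of_real (1 - \<alpha>) *
        (\<Sum>js | length js = k - 1. adjacency_tensor k E (i # js) * prod_list (map (($) x) js))"
    unfolding tensor_apply_def A_alpha_def sum_distrib_left
    by (simp add: sum.distrib[symmetric] algebra_simps)
  then show ?thesis
    unfolding sum_degree_tensor[OF assms(2)] sum_adjacency_tensor[OF assms]
    by (simp only: mult.assoc)
qed

section \<open>The form as a pairing, and changes of one coordinate\<close>

lemma A_alpha_form_eq_sum:
  assumes "uniform_hypergraph k E" and "k > 0"
  shows "A_alpha_form k \<alpha> E x =
    (\<Sum>i\<in>UNIV. x i * (\<alpha> * real (degree E i) * x i ^ (k - 1) + (1 - \<alpha>) * link_sum E x i))"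
proof -
  have p: "x i * x i ^ (k - 1) = x i ^ k" for i
    using assms(2) by (cases k) auto
  have "x i * (\<alpha> * real (degree E i) * x i ^ (k - 1) + (1 - \<alpha>) * link_sum E x i)
      = \<alpha> * (real (degree E i) * x i ^ k) + (1 - \<alpha>) * (x i * link_sum E x i)" for i
    unfolding p[symmetric] by (simp add: algebra_simps)
  then show ?thesis
    by (simp add: sum.distrib sum_distrib_left[symmetric] sum_link_sum[OF assms(1)] A_alpha_form_def)
qed

text \<open>An edge product is affine in \<open>x i\<close>, with slope the product over
  \<open>e - {i}\<close>, which does not involve \<open>x i\<close>. Only the diagonal part
  contributes a \<open>k\<close>-th power of \<open>t\<close>.\<close>

lemma A_alpha_form_fun_upd:
  shows "A_alpha_form k \<alpha> E (x(i := t)) = A_alpha_form k \<alpha> E x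
    + \<alpha> * real (degree E i) * (t ^ k - x i ^ k) + (1 - \<alpha>) * real k * (t - x i) * link_sum E x i"
proof -
  have D: "(\<Sum>j\<in>UNIV. real (degree E j) * (x(i := t)) j ^ k) =
      (\<Sum>j\<in>UNIV. real (degree E j) * x j ^ k) + real (degree E i) * (t ^ k - x i ^ k)"
    by (subst (1 2) sum.remove[of UNIV i]) (auto simp: algebra_simps intro!: sum.cong)
  have inc: "(\<Prod>j\<in>e. (x(i := t)) j) =
      (\<Prod>j\<in>e. x j) + (if i \<in> e then (t - x i) * (\<Prod>j\<in>e - {i}. x j) else 0)" for e
  proof (cases "i \<in> e")
    case True
    have "(\<Prod>j\<in>e - {i}. (x(i := t)) j) = (\<Prod>j\<in>e - {i}. x j)" by (rule prod.cong) auto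
    with True show ?thesis by (simp add: prod_incident algebra_simps)
  qed (auto intro!: prod.cong)
  have "(\<Sum>e\<in>E. \<Prod>j\<in>e. (x(i := t)) j) = (\<Sum>e\<in>E. \<Prod>j\<in>e. x j) + (t - x i) * link_sum E x i"
    unfolding inc link_sum_def
    by (simp add: sum.distrib sum.If_cases sum_distrib_left Int_def)
  with D show ?thesis
    unfolding A_alpha_form_def by (simp add: distrib_left mult.assoc del: fun_upd_apply)
qed

lemma sum_power_fun_upd:
  fixes x :: "'n::finite \<Rightarrow> real"
  shows "(\<Sum>j\<in>UNIV. (x(i := t)) j ^ k) = (\<Sum>j\<in>UNIV. x j ^ k) + (t ^ k - x i ^ k)"
  by (subst (1 2) sum.remove[of UNIV i]) (auto intro!: sum.cong)

lemma A_alpha_form_scale: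
  assumes "uniform_hypergraph k E"
  shows "A_alpha_form k \<alpha> E (\<lambda>i. c * x i) = c ^ k * A_alpha_form k \<alpha> E x"
proof -
  have "(\<Sum>e\<in>E. \<Prod>j\<in>e. c * x j) = (\<Sum>e\<in>E. c ^ k * (\<Prod>j\<in>e. x j))"
    by (rule sum.cong) (auto simp: prod.distrib uniform_hypergraph_card[OF assms])
  then show ?thesis
    by (simp add: A_alpha_form_def power_mult_distrib sum_distrib_left[symmetric] distrib_left
        mult.left_commute)
qed

section \<open>Variational characterization of the spectral radius\<close>

lemma link_sum_nonneg:
  fixes x :: "'n::finite \<Rightarrow> real"
  shows "(\<And>i. x i \<ge> 0) \<Longrightarrow> link_sum E x i \<ge> 0"
  by (auto simp: link_sum_def intro!: sum_nonneg prod_nonneg)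

text \<open>The point \<open>a\<close> minimizes
  \<open>c * (t ^ k - a ^ k) - k * L * (t - a)\<close> over \<open>t \<ge> 0\<close>. If
  \<open>a > 0\<close>, the minimum is interior and the derivative vanishes. If
  \<open>a = 0\<close>, dividing by \<open>t > 0\<close> and letting \<open>t\<close> tend to 0
  gives \<open>k * L \<le> 0\<close>, because \<open>k - 1 > 0\<close>.\<close>

lemma stationary_power_nonneg:
  fixes a c L :: real
  assumes k: "k \<ge> 2" and "a \<ge> 0" and "L \<ge> 0"
    and le: "\<And>t. t \<ge> 0 \<Longrightarrow> real k * L * (t - a) \<le> c * (t ^ k - a ^ k)"
  shows "L = c * a ^ (k - 1)"
proof (cases "a = 0")
  case True
  have "((\<lambda>t. c * t ^ (k - 1)) \<longlongrightarrow> c * 0 ^ (k - 1)) (at_right 0)"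
    by (intro tendsto_intros)
  moreover have "eventually (\<lambda>t. real k * L \<le> c * t ^ (k - 1)) (at_right 0)"
    unfolding eventually_at_right_field
  proof (intro exI[of _ 1] conjI allI impI)
    fix t :: real assume t: "0 < t"
    have "real k * L * t \<le> c * t ^ k" using le[of t] True k t by (simp add: power_0_left)
    also have "t ^ k = t ^ (k - 1) * t" using k by (cases k) auto
    finally show "real k * L \<le> c * t ^ (k - 1)" using t by simp
  qed simp
  ultimately have "real k * L \<le> c * 0 ^ (k - 1)"
    by (rule tendsto_lowerbound) simp
  then have "L = 0" using k \<open>L \<ge> 0\<close> by (simp add: power_0_left mult_le_0_iff)
  then show ?thesis using True k by (simp add: power_0_left)
next
  case False
  then have a: "a > 0" using \<open>a \<ge> 0\<close> by simp
  define g where "g = (\<lambda>t. c * (t ^ k - a ^ k) - real k * L * (t - a))"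
  have "DERIV g a :> c * (real k * a ^ (k - 1)) - real k * L"
    unfolding g_def by (auto intro!: derivative_eq_intros)
  \<comment> \<open>The radius \<open>a\<close> keeps \<open>t\<close> positive, so
    \<open>le\<close> applies throughout the neighbourhood.\<close>
  moreover have "\<forall>t. \<bar>a - t\<bar> < a \<longrightarrow> g a \<le> g t"
    using le by (auto simp: g_def abs_if split: if_splits)
  ultimately have "c * (real k * a ^ (k - 1)) - real k * L = 0"
    using a by (intro DERIV_local_min)
  then have "real k * (c * a ^ (k - 1) - L) = 0" by (simp add: algebra_simps)
  then show ?thesis using k by simp
qed

text \<open>The continuous form attains a maximum on the compact set of nonnegative vectors with
  \<open>k\<close>-th power sum 1; homogeneity of degree \<open>k\<close> carries the bound to all
  nonnegative vectors.\<close>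

lemma A_alpha_form_maximizer:
  fixes E :: "'n::finite set set"
  assumes "uniform_hypergraph k E" and k: "k > 0"
  obtains z where "\<And>i. z i \<ge> 0" and "(\<Sum>i\<in>UNIV. z i ^ k) = 1"
    and "\<And>x. (\<And>i. x i \<ge> 0) \<Longrightarrow>
           A_alpha_form k \<alpha> E x \<le> A_alpha_form k \<alpha> E z * (\<Sum>i\<in>UNIV. x i ^ k)"
proof -
  define S :: "(real ^ 'n) set" where
    "S = {x. (\<forall>i. 0 \<le> x $ i) \<and> (\<Sum>i\<in>UNIV. (x $ i) ^ k) = 1}"
  have "bounded S"
  proof -
    have "norm x \<le> real CARD('n)" if "x \<in> S" for x
    proof -
      have "\<bar>x $ i\<bar> \<le> 1" for i
      proof -
        have "(x $ i) ^ k \<le> (\<Sum>i\<in>UNIV. (x $ i) ^ k)"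
          using that by (intro member_le_sum) (auto simp: S_def)
        then have "(x $ i) ^ k \<le> 1" using that by (simp add: S_def)
        then show ?thesis using that k power_le_one_iff[of "x $ i" k] by (simp add: S_def)
      qed
      then have "(\<Sum>i\<in>UNIV. \<bar>x $ i\<bar>) \<le> (\<Sum>i\<in>(UNIV::'n set). 1)" by (intro sum_mono)
      then show ?thesis using norm_le_l1_cart[of x] by simp
    qed
    then show ?thesis by (auto simp: bounded_iff)
  qed
  moreover have "closed S"
    unfolding S_def
    by (intro closed_Collect_conj closed_Collect_all closed_Collect_le closed_Collect_eq
        continuous_intros)
  ultimately have "compact S" by (simp add: compact_eq_bounded_closed)
  \<comment> \<open>A unit vector at an arbitrary vertex shows that \<open>S\<close> is
    nonempty.\<close>
  moreover have "axis undefined 1 \<in> S"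
    using k sum.delta[of "UNIV :: 'n set" undefined "\<lambda>_. 1 :: real"]
    by (auto simp: S_def axis_def if_distrib[of "\<lambda>y. y ^ k"] power_0_left cong: if_cong)
  moreover have "continuous_on S (\<lambda>x. A_alpha_form k \<alpha> E (($) x))"
    unfolding A_alpha_form_def by (intro continuous_intros)
  ultimately obtain z where z: "z \<in> S"
    and max: "\<And>y. y \<in> S \<Longrightarrow> A_alpha_form k \<alpha> E (($) y) \<le> A_alpha_form k \<alpha> E (($) z)"
    using continuous_attains_sup[of S "\<lambda>x. A_alpha_form k \<alpha> E (($) x)"] by blast
  have "A_alpha_form k \<alpha> E x \<le> A_alpha_form k \<alpha> E (($) z) * (\<Sum>i\<in>UNIV. x i ^ k)"
    if x: "\<And>i. x i \<ge> 0" for x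
  proof (cases "(\<Sum>i\<in>UNIV. x i ^ k) = 0")
    case True
    \<comment> \<open>Here \<open>x\<close> vanishes; scaling by 0 shows that its form is 0.\<close>
    then have "x = (\<lambda>i. 0 * x i)" using x k by (auto simp: sum_nonneg_eq_0_iff)
    then have "A_alpha_form k \<alpha> E x = 0 ^ k * A_alpha_form k \<alpha> E x"
      by (metis A_alpha_form_scale[OF assms(1)])
    then show ?thesis using k True by (simp add: power_0_left)
  next
    case False
    define s where "s = (\<Sum>i\<in>UNIV. x i ^ k)"
    have s: "s > 0" using False x by (simp add: s_def less_le sum_nonneg)
    define c where "c = inverse (root k s)"
    have c: "c ^ k = inverse s" "c > 0"
      using s k by (auto simp: c_def power_inverse)
    have "(\<chi> i. c * x i) \<in> S"
      using x c s by (auto simp: S_def power_mult_distrib sum_distrib_left[symmetric] s_def)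
    moreover have "($) (\<chi> i. c * x i) = (\<lambda>i. c * x i)" by (rule ext) simp
    ultimately have "inverse s * A_alpha_form k \<alpha> E x \<le> A_alpha_form k \<alpha> E (($) z)"
      using max A_alpha_form_scale[OF assms(1), of \<alpha> c x] c by metis
    then show ?thesis using s by (simp add: s_def[symmetric] field_simps)
  qed
  then show ?thesis using that[of "($) z"] z by (auto simp: S_def)
qed

lemma norm_link_sum_le:
  fixes x :: "'n::finite \<Rightarrow> complex"
  shows "cmod (link_sum E x i) \<le> link_sum E (\<lambda>j. cmod (x j)) i"
  unfolding link_sum_def
  by (rule order.trans[OF norm_sum]) (simp add: prod_norm)

text \<open>Take moduli in the \<open>i\<close>-th eigenvalue equation, multiply by the modulus of
  \<open>x $ i\<close> and sum over \<open>i\<close>: the right-hand side becomes the form at the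
  vector of moduli. Its power sum is positive and can be cancelled.\<close>

lemma tensor_eigenvalue_norm_le:
  assumes E: "uniform_hypergraph k E" and k: "k > 0" and \<alpha>: "0 \<le> \<alpha>" "\<alpha> \<le> 1"
    and ev: "tensor_eigenvalue k (A_alpha k \<alpha> E) l"
    and bound: "\<And>x. (\<And>i. x i \<ge> 0) \<Longrightarrow> A_alpha_form k \<alpha> E x \<le> M * (\<Sum>i\<in>UNIV. x i ^ k)"
  shows "cmod l \<le> M"
proof -
  from ev obtain x where "x \<noteq> 0"
    and x: "\<And>i. tensor_apply k (A_alpha k \<alpha> E) x $ i = l * (x $ i) ^ (k - 1)"
    by (auto simp: tensor_eigenvalue_def)
  define y where "y = (\<lambda>i. cmod (x $ i))"
  have "cmod l * y i ^ k
      \<le> y i * (\<alpha> * real (degree E i) * y i ^ (k - 1) + (1 - \<alpha>) * link_sum E y i)" for i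
  proof -
    have "cmod l * y i ^ (k - 1) = cmod (tensor_apply k (A_alpha k \<alpha> E) x $ i)"
      by (simp add: x y_def norm_mult norm_power)
    also have "\<dots> \<le> cmod (of_real \<alpha> * of_nat (degree E i) * (x $ i) ^ (k - 1))
        + cmod (of_real (1 - \<alpha>) * link_sum E (($) x) i)"
      unfolding tensor_apply_A_alpha[OF E k] by (rule norm_triangle_ineq)
    also have "\<dots> \<le> \<alpha> * real (degree E i) * y i ^ (k - 1) + (1 - \<alpha>) * link_sum E y i"
      unfolding norm_mult norm_of_real norm_power norm_of_nat y_def
      using \<alpha> norm_link_sum_le[of E "($) x" i] by (simp add: mult_left_mono)
    finally have "y i * (cmod l * y i ^ (k - 1))
        \<le> y i * (\<alpha> * real (degree E i) * y i ^ (k - 1) + (1 - \<alpha>) * link_sum E y i)"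
      by (rule mult_left_mono) (simp add: y_def)
    moreover have "y i * (cmod l * y i ^ (k - 1)) = cmod l * y i ^ k"
      using k by (cases k) auto
    ultimately show ?thesis by (simp only:)
  qed
  then have "cmod l * (\<Sum>i\<in>UNIV. y i ^ k) \<le> A_alpha_form k \<alpha> E y"
    unfolding A_alpha_form_eq_sum[OF E k] sum_distrib_left by (rule sum_mono)
  also have "\<dots> \<le> M * (\<Sum>i\<in>UNIV. y i ^ k)" by (rule bound) (simp add: y_def)
  finally have le: "cmod l * (\<Sum>i\<in>UNIV. y i ^ k) \<le> M * (\<Sum>i\<in>UNIV. y i ^ k)" .
  obtain i where "x $ i \<noteq> 0" using \<open>x \<noteq> 0\<close> by (auto simp: vec_eq_iff)
  then have "0 < (\<Sum>i\<in>UNIV. y i ^ k)"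
    by (intro sum_pos2[of _ i]) (auto simp: y_def)
  with le show ?thesis by simp
qed

text \<open>Let only coordinate \<open>i\<close> of the maximizer vary. The common value
  \<open>M\<close> cancels from the maximality inequality, leaving the hypothesis of
  \<open>stationary_power_nonneg\<close> with \<open>L = (1 - \<alpha>) * link_sum E z i\<close> and
  \<open>c = M - \<alpha> * degree E i\<close>. Its conclusion is the eigenvalue equation at
  \<open>i\<close>.\<close>

lemma A_alpha_form_maximum_eigenvalue:
  fixes E :: "'n::finite set set"
  assumes E: "uniform_hypergraph k E" and k: "k \<ge> 2" and \<alpha>: "\<alpha> \<le> 1"
    and z: "\<And>i. z i \<ge> 0" "(\<Sum>i\<in>UNIV. z i ^ k) = 1"
    and max: "\<And>x. (\<And>i. x i \<ge> 0) \<Longrightarrow>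
           A_alpha_form k \<alpha> E x \<le> A_alpha_form k \<alpha> E z * (\<Sum>i\<in>UNIV. x i ^ k)"
  shows "tensor_eigenvalue k (A_alpha k \<alpha> E) (of_real (A_alpha_form k \<alpha> E z))"
proof -
  define M where "M = A_alpha_form k \<alpha> E z"
  define x :: "complex ^ 'n" where "x = (\<chi> i. of_real (z i))"
  have "(1 - \<alpha>) * link_sum E z i = (M - \<alpha> * real (degree E i)) * z i ^ (k - 1)" for i
  proof (rule stationary_power_nonneg[OF k])
    show "(1 - \<alpha>) * link_sum E z i \<ge> 0"
      using \<alpha> z(1) by (simp add: link_sum_nonneg)
  next
    fix t :: real assume "t \<ge> 0"
    then have "A_alpha_form k \<alpha> E (z(i := t)) \<le> M * (\<Sum>j\<in>UNIV. (z(i := t)) j ^ k)"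
      unfolding M_def using z(1) by (intro max) auto
    then show "real k * ((1 - \<alpha>) * link_sum E z i) * (t - z i)
        \<le> (M - \<alpha> * real (degree E i)) * (t ^ k - z i ^ k)"
      unfolding A_alpha_form_fun_upd sum_power_fun_upd z(2) M_def[symmetric]
      by (simp add: algebra_simps)
  qed (use z in auto)
  then have eig: "\<alpha> * real (degree E i) * z i ^ (k - 1) + (1 - \<alpha>) * link_sum E z i
      = M * z i ^ (k - 1)" for i
    by (simp add: algebra_simps)
  have "tensor_apply k (A_alpha k \<alpha> E) x $ i = of_real M * (x $ i) ^ (k - 1)" for i
  proof -
    have "tensor_apply k (A_alpha k \<alpha> E) x $ i =
        of_real (\<alpha> * real (degree E i) * z i ^ (k - 1) + (1 - \<alpha>) * link_sum E z i)"
      using k by (simp add: tensor_apply_A_alpha[OF E] x_def link_sum_def)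
    then show ?thesis unfolding eig by (simp add: x_def)
  qed
  moreover have "x \<noteq> 0"
  proof
    assume "x = 0"
    then have "z i = 0" for i by (simp add: x_def vec_eq_iff)
    then show False using z(2) k by (simp add: power_0_left)
  qed
  ultimately show ?thesis by (auto simp: tensor_eigenvalue_def M_def)
qed

lemma A_alpha_form_le_rho_alpha:
  assumes E: "uniform_hypergraph k E" and k: "k \<ge> 2" and \<alpha>: "0 \<le> \<alpha>" "\<alpha> \<le> 1"
    and x: "\<And>i. x i \<ge> 0"
  shows "A_alpha_form k \<alpha> E x \<le> rho_alpha k \<alpha> E * (\<Sum>i\<in>UNIV. x i ^ k)"
proof -
  have k0: "k > 0" using k by simp
  obtain z where z: "\<And>i. z i \<ge> 0" "(\<Sum>i\<in>UNIV. z i ^ k) = 1"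
    and max: "\<And>x. (\<And>i. x i \<ge> 0) \<Longrightarrow>
           A_alpha_form k \<alpha> E x \<le> A_alpha_form k \<alpha> E z * (\<Sum>i\<in>UNIV. x i ^ k)"
    using A_alpha_form_maximizer[OF E k0] by blast
  \<comment> \<open>The spectral radius is a modulus, so the eigenvalue found must equal its own
    modulus.\<close>
  have nonneg: "A_alpha_form k \<alpha> E z \<ge> 0"
    unfolding A_alpha_form_eq_sum[OF E k0]
    using \<alpha> z(1) by (intro sum_nonneg) (simp add: link_sum_nonneg)
  have "rho_alpha k \<alpha> E = A_alpha_form k \<alpha> E z"
    unfolding rho_alpha_def tensor_spectral_radius_def
  proof (rule Greatest_equality)
    show "\<exists>l. tensor_eigenvalue k (A_alpha k \<alpha> E) l \<and> A_alpha_form k \<alpha> E z = cmod l"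
      using A_alpha_form_maximum_eigenvalue[OF E k \<alpha>(2) z max] nonneg
      by (intro exI[of _ "of_real (A_alpha_form k \<alpha> E z)"]) simp
  next
    fix r assume "\<exists>l. tensor_eigenvalue k (A_alpha k \<alpha> E) l \<and> r = cmod l"
    then show "r \<le> A_alpha_form k \<alpha> E z"
      using tensor_eigenvalue_norm_le[OF E k0 \<alpha> _ max] by blast
  qed
  then show ?thesis using max[OF x] by simp
qed

section \<open>Test vectors and the degree bound\<close>

lemma A_alpha_form_perturbed_ones:
  assumes "uniform_hypergraph k E"
  shows "A_alpha_form k \<alpha> E ((\<lambda>_. 1)(i := t)) = real k * real (card E)
    + \<alpha> * real (degree E i) * (t ^ k - 1) + (1 - \<alpha>) * real k * real (degree E i) * (t - 1)"
proof -
  have "(\<Sum>i\<in>UNIV. real (degree E i)) = real k * real (card E)"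
    using arg_cong[OF sum_degree[OF assms], of real] by simp
  then have "A_alpha_form k \<alpha> E (\<lambda>_. 1) = real k * real (card E)"
    by (simp add: A_alpha_form_def algebra_simps)
  \<comment> \<open>At the all-ones vector every link sum is the degree of its vertex.\<close>
  then show ?thesis
    unfolding A_alpha_form_fun_upd by (simp add: link_sum_def degree_def)
qed

text \<open>The two test vectors have power sums \<open>n + a ^ k - 1\<close> and
  \<open>n + b ^ k - 1\<close>. The constraint on \<open>a\<close> and \<open>b\<close> makes their
  total exactly \<open>2 * n\<close>. As the vectors are separate, \<open>u = v\<close> is
  allowed.\<close>

lemma rho_alpha_two_vertices:
  fixes E :: "'n::finite set set" and u v :: 'n
  assumes E: "uniform_hypergraph k E" and k: "k \<ge> 2" and \<alpha>: "0 \<le> \<alpha>" "\<alpha> \<le> 1"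
    and ab: "a \<ge> 0" "b \<ge> 0" "a ^ k + b ^ k = 2"
  defines "p \<equiv> real (degree E u)" and "q \<equiv> real (degree E v)"
  shows "rho_alpha k \<alpha> E - real k * real (card E) / real CARD('n) \<ge>
    \<alpha> / (2 * real CARD('n)) * (p * a ^ k + q * b ^ k - (p + q))
    + (1 - \<alpha>) * real k / (2 * real CARD('n)) * (p * a + q * b - (p + q))"
proof -
  define n where "n = real CARD('n)"
  define r where "r = rho_alpha k \<alpha> E"
  have n: "n > 0" by (simp add: n_def)
  have *: "A_alpha_form k \<alpha> E ((\<lambda>_. 1)(w := t)) \<le> r * (n + (t ^ k - 1))" if "t \<ge> 0" for w t
    using A_alpha_form_le_rho_alpha[OF E k \<alpha>, of "(\<lambda>_. 1)(w := t)"] that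
    by (simp add: sum_power_fun_upd n_def r_def del: fun_upd_apply) simp
  have "r * (n + (a ^ k - 1)) + r * (n + (b ^ k - 1)) = r * (2 * n + (a ^ k + b ^ k) - 2)"
    by (simp add: algebra_simps)
  also have "\<dots> = 2 * n * r" by (simp add: ab(3))
  finally have "2 * (real k * real (card E)) + \<alpha> * (p * a ^ k + q * b ^ k - (p + q))
      + (1 - \<alpha>) * real k * (p * a + q * b - (p + q)) \<le> 2 * n * r"
    using *[OF ab(1), of u] *[OF ab(2), of v]
    unfolding A_alpha_form_perturbed_ones[OF E] p_def q_def by (simp add: algebra_simps)
  then have "(2 * (real k * real (card E)) + \<alpha> * (p * a ^ k + q * b ^ k - (p + q))
      + (1 - \<alpha>) * real k * (p * a + q * b - (p + q))) / (2 * n) \<le> r"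
    using n by (simp add: pos_divide_le_eq mult.commute)
  then show ?thesis
    unfolding n_def[symmetric] r_def[symmetric] by (simp add: add_divide_distrib)
qed

text \<open>Ensures that the sum of degree powers in the final bound is positive even when the
  minimum degree is 0.\<close>

lemma max_degree_pos:
  assumes "uniform_hypergraph k E" and "k > 0"
  shows "max_degree E > 0"
proof -
  obtain e where e: "e \<in> E" using assms by (auto simp: uniform_hypergraph_def)
  then have "e \<noteq> {}" using uniform_hypergraph_card[OF assms(1) e] assms(2) by auto
  then obtain i where "i \<in> e" by blast
  with e have "degree E i > 0" by (auto simp: degree_def card_gt_0_iff)
  also have "degree E i \<le> max_degree E" by (simp add: max_degree_def)
  finally show ?thesis .
qed

theorem theorem4p25:
  fixes k :: nat and \<alpha> :: real and E :: "'n::finite set set"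
    and n m \<Delta> \<delta> :: real
  assumes "k \<ge> 2" and "0 \<le> \<alpha>" and "\<alpha> < 1"
    and "uniform_hypergraph k E"
    and "n = real CARD('n)" and "m = real (card E)"
    and "\<Delta> = real (max_degree E)" and "\<delta> = real (min_degree E)"
  shows "rho_alpha k \<alpha> E - real k * m / n \<ge>
    \<alpha> / (2 * n) *
      (2 * (\<Delta> powr ((2 * real k - 1) / (real k - 1)) + \<delta> powr ((2 * real k - 1) / (real k - 1)))
         / (\<Delta> powr (real k / (real k - 1)) + \<delta> powr (real k / (real k - 1)))
       - (\<Delta> + \<delta>))
    + (1 - \<alpha>) * real k / (2 * n) *
      (2 powr (1 / real k)
         * (\<Delta> powr (real k / (real k - 1)) + \<delta> powr (real k / (real k - 1))) powr ((real k - 1) / real k)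
       - (\<Delta> + \<delta>))"
proof -
  note k = assms(1)
  define s where "s = \<Delta> powr (real k / (real k - 1)) + \<delta> powr (real k / (real k - 1))"
  \<comment> \<open>The values \<open>f \<Delta>\<close> and \<open>f \<delta>\<close> serve as
    \<open>a\<close> and \<open>b\<close>. They maximize \<open>\<Delta> * a + \<delta> * b\<close>
    under \<open>a ^ k + b ^ k = 2\<close>: equality in Hoelder's inequality requires
    \<open>a ^ (k - 1)\<close> and \<open>b ^ (k - 1)\<close> proportional to the degrees, and the
    factor \<open>(2 / s) powr (1 / k)\<close> normalises.\<close>
  define f where "f = (\<lambda>d. (2 / s) powr (1 / real k) * d powr (1 / (real k - 1)))"
  have "\<Delta> > 0" using max_degree_pos[OF assms(4)] k assms(7) by simp
  then have s: "s > 0" by (simp add: s_def add_pos_nonneg)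
  have "max_degree E \<in> range (degree E)" "min_degree E \<in> range (degree E)"
    unfolding max_degree_def min_degree_def by (intro Max_in Min_in; simp)+
  then obtain u v where uv: "\<Delta> = real (degree E u)" "\<delta> = real (degree E v)"
    using assms(7,8) by auto
  have f_nonneg: "f d \<ge> 0" for d by (simp add: f_def)
  have f_power: "f d ^ k = 2 / s * d powr (real k / (real k - 1))" for d
  proof -
    have "f d ^ k = ((2 / s) powr (1 / real k)) ^ k * (d powr (1 / (real k - 1))) ^ k"
      by (simp add: f_def power_mult_distrib)
    also have "((2 / s) powr (1 / real k)) ^ k = 2 / s"
      using k s by (simp add: powr_power)
    \<comment> \<open>The case \<open>d = 0\<close> can occur for the minimum degree; there
      \<open>0 powr _ = 0\<close> makes both sides 0.\<close>
    also have "(d powr (1 / (real k - 1))) ^ k = d powr (real k / (real k - 1))"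
      using k by (cases "d = 0") (simp_all add: powr_power mult.commute power_0_left)
    finally show ?thesis .
  qed
  have mult_powr: "d * d powr e = d powr (e + 1)" if "d \<ge> 0" for d e :: real
    using that by (simp add: powr_mult_base add.commute)
  \<comment> \<open>Multiplication by a degree raises the exponent by 1; this produces the exponents
    of the claim.\<close>
  have e1: "real k / (real k - 1) + 1 = (2 * real k - 1) / (real k - 1)"
    and e2: "1 / (real k - 1) + 1 = real k / (real k - 1)"
    using k by (simp_all add: field_simps)
  have d_nonneg: "\<Delta> \<ge> 0" "\<delta> \<ge> 0" by (simp_all add: assms(7,8))
  have diag: "d * f d ^ k = 2 / s * d powr ((2 * real k - 1) / (real k - 1))" if "d \<ge> 0" for d
    unfolding f_power e1[symmetric] mult_powr[OF that, symmetric] by simp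
  have adj: "d * f d = (2 / s) powr (1 / real k) * d powr (real k / (real k - 1))" if "d \<ge> 0" for d
    unfolding f_def e2[symmetric] mult_powr[OF that, symmetric] by simp
  have "f \<Delta> ^ k + f \<delta> ^ k = 2 / s * s"
    unfolding f_power by (simp add: s_def distrib_left)
  then have total: "f \<Delta> ^ k + f \<delta> ^ k = 2" using s by simp
  have "\<Delta> * f \<Delta> ^ k + \<delta> * f \<delta> ^ k =
      2 * (\<Delta> powr ((2 * real k - 1) / (real k - 1)) + \<delta> powr ((2 * real k - 1) / (real k - 1))) / s"
    by (simp add: diag d_nonneg add_divide_distrib)
  moreover have "\<Delta> * f \<Delta> + \<delta> * f \<delta> = 2 powr (1 / real k) * s powr ((real k - 1) / real k)"
  proof -
    have "\<Delta> * f \<Delta> + \<delta> * f \<delta> = (2 / s) powr (1 / real k) * s"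
      by (simp add: adj d_nonneg s_def distrib_left)
    \<comment> \<open>Writing \<open>s\<close> as \<open>s powr 1\<close> leaves the power
      \<open>1 - 1 / k\<close> of \<open>s\<close>.\<close>
    also have "\<dots> = 2 powr (1 / real k) * (s powr 1 / s powr (1 / real k))"
      using s by (simp add: powr_divide)
    also have "s powr 1 / s powr (1 / real k) = s powr ((real k - 1) / real k)"
      unfolding powr_diff[symmetric] using k by (simp add: diff_divide_distrib)
    finally show ?thesis .
  qed
  ultimately show ?thesis
    using rho_alpha_two_vertices[OF assms(4) k assms(2) less_imp_le[OF assms(3)]
        f_nonneg f_nonneg total, of u v]
    unfolding s_def[symmetric] assms(5,6) uv[symmetric] by simp
qed

end
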